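(* Let $R$ be a reduced noetherian local commutative ring, let $M$ be a finitely generated reflexive $R$-module, and let $R \subseteq R'$ be a finite birational extension. Then the following two assertions are equivalent: (1) $\tau_R(M)\subseteq \mathcal{C}_{R'/R}$, where $\mathcal{C}_{R'/R}$ is the conductor of $R'$ in $R$; (2) $M$ is a module over $R'$.
   Context: Let $Q(R)$ denote the total ring of fractions of $R$. A finite birational extension of $R$ is a ring $R'$ with $R\subseteq R'\subseteq Q(R)$ that is finitely generated as an $R$-module. The (relative) conductor of $R'$ in $R$ is $\mathcal{C}_{R'/R}=\{a\in Q(R): aR'\subseteq R\}$; it is an ideal of both $R$ and $R'$. For an $R$-module $M$ put $M^*=\operatorname{Hom}_R(M,R)$. The trace ideal of $M$ is $\tau_R(M)$, the ideal of $R$ generated by all elements $f(m)$ with $f\in M^*$ and $m\in M$. $M$ is reflexive if the canonical map $M\to M^{**}$ is an isomorphism. "$M$ is a module over $R'$" means that the given $R$-module structure on $M$ extends to an $R'$-module structure. *)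

theory Defs
  imports "HOL-Algebra.Algebra"
begin

definition local_cring :: "('a, 'm) ring_scheme \<Rightarrow> bool" where
  "local_cring R \<longleftrightarrow> cring R \<and> (\<exists>!I. maximalideal I R)"

definition reduced_ring :: "('a, 'm) ring_scheme \<Rightarrow> bool" where
  "reduced_ring R \<longleftrightarrow>
     (\<forall>x \<in> carrier R. \<forall>n::nat. x [^]\<^bsub>R\<^esub> n = \<zero>\<^bsub>R\<^esub> \<longrightarrow> x = \<zero>\<^bsub>R\<^esub>)"

text \<open>Inclusions of rings are literal: the carrier of the smaller ring is a subset of that of the
  larger one, and the operations are the same.\<close>

definition is_subring_of :: "'a ring \<Rightarrow> 'a ring \<Rightarrow> bool" where
  "is_subring_of R S \<longleftrightarrow> subring (carrier R) S \<and> R = S\<lparr>carrier := carrier R\<rparr>"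

definition regular_elements :: "('a, 'm) ring_scheme \<Rightarrow> 'a set" where
  "regular_elements R =
     {s \<in> carrier R. \<forall>a \<in> carrier R. s \<otimes>\<^bsub>R\<^esub> a = \<zero>\<^bsub>R\<^esub> \<longrightarrow> a = \<zero>\<^bsub>R\<^esub>}"

text \<open>The localization of \<open>R\<close> at its regular elements, which is unique up to a unique isomorphism
  over \<open>R\<close>. The map from \<open>R\<close> to it is injective and is taken to be an inclusion.\<close>

definition total_ring_of_fractions :: "'a ring \<Rightarrow> 'a ring \<Rightarrow> bool" where
  "total_ring_of_fractions R Q \<longleftrightarrow>
     cring Q \<and> is_subring_of R Q \<and>
     regular_elements R \<subseteq> Units Q \<and>
     (\<forall>q \<in> carrier Q. \<exists>a \<in> carrier R. \<exists>s \<in> regular_elements R. q = a \<otimes>\<^bsub>Q\<^esub> inv\<^bsub>Q\<^esub> s)"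

definition fin_gen_module :: "('a, 'm) ring_scheme \<Rightarrow> ('a, 'c, 'n) module_scheme \<Rightarrow> bool" where
  "fin_gen_module R M \<longleftrightarrow> module R M \<and>
     (\<exists>S \<subseteq> carrier M. finite S \<and> (\<forall>N. submodule N R M \<and> S \<subseteq> N \<longrightarrow> N = carrier M))"

text \<open>A ring \<open>S\<close> as a module over itself, or over any subring of \<open>S\<close>.\<close>

definition ring_as_module :: "('a, 'm) ring_scheme \<Rightarrow> ('a, 'a) module" where
  "ring_as_module S =
     \<lparr>carrier = carrier S, monoid.mult = monoid.mult S, monoid.one = monoid.one S, ring.zero = ring.zero S, ring.add = ring.add S,
      smult = monoid.mult S\<rparr>"

definition finite_birational_extension :: "'a ring \<Rightarrow> 'a ring \<Rightarrow> 'a ring \<Rightarrow> bool" where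
  "finite_birational_extension R Q R' \<longleftrightarrow>
     total_ring_of_fractions R Q \<and> is_subring_of R R' \<and> is_subring_of R' Q \<and>
     fin_gen_module R (ring_as_module R')"

definition conductor :: "'a ring \<Rightarrow> 'a ring \<Rightarrow> 'a ring \<Rightarrow> 'a set" where
  "conductor R Q R' = {a \<in> carrier Q. \<forall>x \<in> carrier R'. a \<otimes>\<^bsub>Q\<^esub> x \<in> carrier R}"

text \<open>Homomorphisms are extensional functions, so that equality of homomorphisms is equality on
  the carrier of the source.\<close>

definition module_homs ::
  "('a, 'm) ring_scheme \<Rightarrow> ('a, 'c, 'n) module_scheme \<Rightarrow> ('a, 'd, 'k) module_scheme \<Rightarrow>
   ('c \<Rightarrow> 'd) set" where
  "module_homs R M N =
     {f \<in> carrier M \<rightarrow>\<^sub>E carrier N.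
        (\<forall>x \<in> carrier M. \<forall>y \<in> carrier M. f (x \<oplus>\<^bsub>M\<^esub> y) = f x \<oplus>\<^bsub>N\<^esub> f y) \<and>
        (\<forall>r \<in> carrier R. \<forall>x \<in> carrier M. f (r \<odot>\<^bsub>M\<^esub> x) = r \<odot>\<^bsub>N\<^esub> f x)}"

text \<open>The fields \<open>mult\<close> and \<open>one\<close> of a module record play no role in the locale \<open>module\<close>.\<close>

definition Hom_module ::
  "('a, 'm) ring_scheme \<Rightarrow> ('a, 'c, 'n) module_scheme \<Rightarrow> ('a, 'd, 'k) module_scheme \<Rightarrow>
   ('a, 'c \<Rightarrow> 'd) module" where
  "Hom_module R M N =
     \<lparr>carrier = module_homs R M N, monoid.mult = undefined, monoid.one = undefined,
      ring.zero = (\<lambda>x \<in> carrier M. \<zero>\<^bsub>N\<^esub>),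
      ring.add = (\<lambda>f g. \<lambda>x \<in> carrier M. f x \<oplus>\<^bsub>N\<^esub> g x),
      smult = (\<lambda>r f. \<lambda>x \<in> carrier M. r \<odot>\<^bsub>N\<^esub> f x)\<rparr>"

definition dual_module ::
  "('a, 'm) ring_scheme \<Rightarrow> ('a, 'c, 'n) module_scheme \<Rightarrow> ('a, 'c \<Rightarrow> 'a) module" where
  "dual_module R M = Hom_module R M (ring_as_module R)"

definition canonical_bidual_map ::
  "('a, 'm) ring_scheme \<Rightarrow> ('a, 'c, 'n) module_scheme \<Rightarrow> 'c \<Rightarrow> ('c \<Rightarrow> 'a) \<Rightarrow> 'a" where
  "canonical_bidual_map R M = (\<lambda>x \<in> carrier M. \<lambda>f \<in> carrier (dual_module R M). f x)"

definition module_isos ::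
  "('a, 'm) ring_scheme \<Rightarrow> ('a, 'c, 'n) module_scheme \<Rightarrow> ('a, 'd, 'k) module_scheme \<Rightarrow>
   ('c \<Rightarrow> 'd) set" where
  "module_isos R M N = {f \<in> module_homs R M N. bij_betw f (carrier M) (carrier N)}"

definition reflexive_module :: "('a, 'm) ring_scheme \<Rightarrow> ('a, 'c, 'n) module_scheme \<Rightarrow> bool" where
  "reflexive_module R M \<longleftrightarrow> module R M \<and>
     canonical_bidual_map R M \<in> module_isos R M (dual_module R (dual_module R M))"

definition trace_ideal :: "('a, 'm) ring_scheme \<Rightarrow> ('a, 'c, 'n) module_scheme \<Rightarrow> 'a set" where
  "trace_ideal R M =
     Idl\<^bsub>R\<^esub> {f x | f x. f \<in> carrier (dual_module R M) \<and> x \<in> carrier M}"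

definition module_structure_extends ::
  "('a, 'm) ring_scheme \<Rightarrow> ('a, 'k) ring_scheme \<Rightarrow> ('a, 'c, 'n) module_scheme \<Rightarrow> bool" where
  "module_structure_extends R R' M \<longleftrightarrow>
     (\<exists>sm. module R' (M\<lparr>smult := sm\<rparr>) \<and>
           (\<forall>r \<in> carrier R. \<forall>x \<in> carrier M. sm r x = r \<odot>\<^bsub>M\<^esub> x))"

end

theory Submission
  imports Defs
begin

text \<open>If \<open>M\<close> is an \<open>R'\<close>-module, every \<open>R\<close>-linear form \<open>f\<close> on \<open>M\<close> satisfies \<open>f (q m) = q f m\<close> in \<open>Q\<close>,
  because a denominator of \<open>q\<close> is a unit of \<open>Q\<close>; so \<open>q f m\<close> lies in \<open>R\<close>. Conversely, if the trace
  ideal lies in the conductor, then for \<open>q\<close> in \<open>R'\<close> and \<open>m\<close> in \<open>M\<close> the map \<open>f \<mapsto> q f m\<close> is an element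
  of the bidual. By reflexivity it is evaluation at a unique element of \<open>M\<close>, which is taken as \<open>q m\<close>;
  the module axioms hold because linear forms separate the points of \<open>M\<close>.\<close>

section \<open>Inclusions of rings\<close>

lemma is_subring_ofD:
  assumes "is_subring_of R S"
  shows "subring (carrier R) S" "carrier R \<subseteq> carrier S"
    "monoid.mult R = monoid.mult S" "ring.add R = ring.add S"
    "\<one>\<^bsub>R\<^esub> = \<one>\<^bsub>S\<^esub>" "\<zero>\<^bsub>R\<^esub> = \<zero>\<^bsub>S\<^esub>"
proof -
  have eq: "R = S\<lparr>carrier := carrier R\<rparr>" and sub: "subring (carrier R) S"
    using assms by (auto simp: is_subring_of_def)
  show "subring (carrier R) S" by (fact sub)
  show "carrier R \<subseteq> carrier S" using subringE(1)[OF sub] .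
  show "monoid.mult R = monoid.mult S" by (subst eq) simp
  show "ring.add R = ring.add S" by (subst eq) simp
  show "\<one>\<^bsub>R\<^esub> = \<one>\<^bsub>S\<^esub>" by (subst eq) simp
  show "\<zero>\<^bsub>R\<^esub> = \<zero>\<^bsub>S\<^esub>" by (subst eq) simp
qed

lemma is_subring_of_cring:
  assumes "is_subring_of R S" and "cring S"
  shows "cring R"
proof -
  interpret S: cring S by fact
  have "cring (S\<lparr>carrier := carrier R\<rparr>)"
    using S.subcring_iff[OF is_subring_ofD(2)[OF assms(1)]]
      S.subcringI'[OF is_subring_ofD(1)[OF assms(1)]] by simp
  then show ?thesis
    using assms(1) by (metis is_subring_of_def)
qed

section \<open>Linear forms and the dual module\<close>

lemma ring_as_module_simps [simp]:
  "carrier (ring_as_module S) = carrier S"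
  "ring.add (ring_as_module S) = ring.add S"
  "smult (ring_as_module S) = monoid.mult S"
  by (simp_all add: ring_as_module_def)

lemma dual_module_simps [simp]:
  "ring.add (dual_module R M) = (\<lambda>f g. \<lambda>x \<in> carrier M. f x \<oplus>\<^bsub>R\<^esub> g x)"
  "smult (dual_module R M) = (\<lambda>r f. \<lambda>x \<in> carrier M. r \<otimes>\<^bsub>R\<^esub> f x)"
  by (simp_all add: dual_module_def Hom_module_def)

lemma dual_module_carrier_iff:
  "f \<in> carrier (dual_module R M) \<longleftrightarrow>
     f \<in> carrier M \<rightarrow>\<^sub>E carrier R \<and>
     (\<forall>x \<in> carrier M. \<forall>y \<in> carrier M. f (x \<oplus>\<^bsub>M\<^esub> y) = f x \<oplus>\<^bsub>R\<^esub> f y) \<and>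
     (\<forall>r \<in> carrier R. \<forall>x \<in> carrier M. f (r \<odot>\<^bsub>M\<^esub> x) = r \<otimes>\<^bsub>R\<^esub> f x)"
  by (simp add: dual_module_def Hom_module_def module_homs_def)

lemma dual_moduleD:
  assumes "f \<in> carrier (dual_module R M)"
  shows "x \<in> carrier M \<Longrightarrow> f x \<in> carrier R"
    "x \<in> carrier M \<Longrightarrow> y \<in> carrier M \<Longrightarrow> f (x \<oplus>\<^bsub>M\<^esub> y) = f x \<oplus>\<^bsub>R\<^esub> f y"
    "r \<in> carrier R \<Longrightarrow> x \<in> carrier M \<Longrightarrow> f (r \<odot>\<^bsub>M\<^esub> x) = r \<otimes>\<^bsub>R\<^esub> f x"
  using assms by (auto simp: dual_module_carrier_iff)

text \<open>Elements of the bidual are extensional functions on the dual, so their value at a sum of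
  forms can be unfolded only once the sum is known to be a form.\<close>

lemma dual_module_add_closed:
  assumes "module R M"
    and "f \<in> carrier (dual_module R M)" "g \<in> carrier (dual_module R M)"
  shows "(\<lambda>x \<in> carrier M. f x \<oplus>\<^bsub>R\<^esub> g x) \<in> carrier (dual_module R M)"
proof -
  interpret module R M by fact
  note f = dual_moduleD[OF assms(2)] and g = dual_moduleD[OF assms(3)]
  show ?thesis
    unfolding dual_module_carrier_iff
    by (auto simp: f g R.r_distr R.add.m_ac)
qed

text \<open>Commutativity of \<open>R\<close> keeps the multiple linear: r (s f x) = s (r f
  x).\<close>

lemma dual_module_smult_closed:
  assumes "module R M" and "r \<in> carrier R" and "f \<in> carrier (dual_module R M)"
  shows "(\<lambda>x \<in> carrier M. r \<otimes>\<^bsub>R\<^esub> f x) \<in> carrier (dual_module R M)"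
proof -
  interpret module R M by fact
  note f = dual_moduleD[OF assms(3)]
  show ?thesis
    unfolding dual_module_carrier_iff
    using assms(2) by (auto simp: f R.r_distr R.m_lcomm)
qed

section \<open>The two halves of reflexivity\<close>

text \<open>Injectivity of the canonical map: points with the same value under every form have the
  same image in the bidual.\<close>

lemma reflexive_module_separates:
  assumes "reflexive_module R M" and "x \<in> carrier M" "y \<in> carrier M"
    and "\<And>f. f \<in> carrier (dual_module R M) \<Longrightarrow> f x = f y"
  shows "x = y"
proof -
  have "inj_on (canonical_bidual_map R M) (carrier M)"
    using assms(1) by (auto simp: reflexive_module_def module_isos_def bij_betw_def)
  moreover have "canonical_bidual_map R M x = canonical_bidual_map R M y"
    using assms(2-4) by (auto simp: canonical_bidual_map_def intro!: restrict_ext)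
  ultimately show ?thesis using assms(2,3) by (auto dest: inj_onD)
qed

text \<open>Surjectivity of the canonical map: any preimage of the functional represents it by
  evaluation.\<close>

lemma reflexive_module_evaluation:
  assumes "reflexive_module R M"
    and "\<phi> \<in> carrier (dual_module R (dual_module R M))"
  obtains x where "x \<in> carrier M" "\<And>f. f \<in> carrier (dual_module R M) \<Longrightarrow> f x = \<phi> f"
proof -
  have "\<phi> \<in> canonical_bidual_map R M ` carrier M"
    using assms by (auto simp: reflexive_module_def module_isos_def bij_betw_def)
  then obtain x where "x \<in> carrier M" "\<phi> = canonical_bidual_map R M x" by auto
  then show ?thesis using that by (auto simp: canonical_bidual_map_def)
qed

section \<open>The conductor\<close>

text \<open>The trace ideal is the smallest ideal containing all values of forms, so its inclusion
  in the conductor need only be tested on these values.\<close>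

lemma conductor_ideal:
  assumes "cring Q" and "is_subring_of R' Q" and "is_subring_of R Q"
  shows "ideal (conductor R Q R') R"
proof -
  interpret Q: cring Q by fact
  interpret R: cring R using is_subring_of_cring assms(1,3) by blast
  interpret R': cring R' using is_subring_of_cring assms(1,2) by blast
  note RQ = is_subring_ofD[OF assms(3)] and R'Q = is_subring_ofD[OF assms(2)]
  have sub: "conductor R Q R' \<subseteq> carrier R"
  proof
    fix a assume a: "a \<in> conductor R Q R'"
    \<comment> \<open>Testing with the unit of \<open>R'\<close>, which is that of \<open>Q\<close>,
      places \<open>a\<close> itself in \<open>R\<close>.\<close>
    then have "a \<otimes>\<^bsub>Q\<^esub> \<one>\<^bsub>R'\<^esub> \<in> carrier R" by (auto simp: conductor_def)
    then show "a \<in> carrier R" using a R'Q(5) by (auto simp: conductor_def)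
  qed
  have zero: "\<zero>\<^bsub>R\<^esub> \<in> conductor R Q R'"
    using R.zero_closed RQ(6) R'Q(2) by (auto simp: conductor_def)
  have add: "a \<oplus>\<^bsub>R\<^esub> b \<in> conductor R Q R'"
    if "a \<in> conductor R Q R'" "b \<in> conductor R Q R'" for a b
  proof -
    have "(a \<oplus>\<^bsub>Q\<^esub> b) \<otimes>\<^bsub>Q\<^esub> x \<in> carrier R" if x: "x \<in> carrier R'" for x
    proof -
      have "(a \<oplus>\<^bsub>Q\<^esub> b) \<otimes>\<^bsub>Q\<^esub> x = (a \<otimes>\<^bsub>Q\<^esub> x) \<oplus>\<^bsub>R\<^esub> (b \<otimes>\<^bsub>Q\<^esub> x)"
        using x \<open>a \<in> conductor R Q R'\<close> \<open>b \<in> conductor R Q R'\<close> R'Q(2) RQ(4)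
        by (auto simp: conductor_def Q.l_distr subset_iff)
      then show ?thesis
        using x \<open>a \<in> conductor R Q R'\<close> \<open>b \<in> conductor R Q R'\<close> by (auto simp: conductor_def)
    qed
    then show ?thesis using that RQ(4) by (auto simp: conductor_def)
  qed
  have mult: "r \<otimes>\<^bsub>R\<^esub> a \<in> conductor R Q R'"
    if a: "a \<in> conductor R Q R'" and r: "r \<in> carrier R" for a r
  proof -
    have "(r \<otimes>\<^bsub>Q\<^esub> a) \<otimes>\<^bsub>Q\<^esub> x \<in> carrier R" if x: "x \<in> carrier R'" for x
    proof -
      have "(r \<otimes>\<^bsub>Q\<^esub> a) \<otimes>\<^bsub>Q\<^esub> x = r \<otimes>\<^bsub>R\<^esub> (a \<otimes>\<^bsub>Q\<^esub> x)"
        using x a r R'Q(2) RQ(2,3) by (auto simp: conductor_def Q.m_assoc subset_iff)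
      then show ?thesis using x a r by (auto simp: conductor_def)
    qed
    then show ?thesis using a r RQ(2,3) by (auto simp: conductor_def)
  qed
  \<comment> \<open>Negation is multiplication by -1, so it is covered by
    \<open>mult\<close>.\<close>
  have inv: "\<ominus>\<^bsub>R\<^esub> a \<in> conductor R Q R'" if "a \<in> conductor R Q R'" for a
    using mult[OF that R.a_inv_closed[OF R.one_closed]] that sub
    by (auto simp: R.l_minus subset_iff)
  show ?thesis
  proof (rule idealI)
    show "ring R" by (rule R.ring_axioms)
    show "subgroup (conductor R Q R') (add_monoid R)"
      using sub zero add inv
      by (intro R.add.subgroupI) (auto simp: a_inv_def[symmetric])
    show "r \<otimes>\<^bsub>R\<^esub> a \<in> conductor R Q R'" if "a \<in> conductor R Q R'" "r \<in> carrier R" for a r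
      using mult that by blast
    show "a \<otimes>\<^bsub>R\<^esub> r \<in> conductor R Q R'" if "a \<in> conductor R Q R'" "r \<in> carrier R" for a r
      using mult[OF that] that sub by (metis R.m_comm subsetD)
  qed
qed

section \<open>From a module structure over the extension to the inclusion\<close>

lemma trace_subset_conductor_if_extends:
  assumes "module R M" and "total_ring_of_fractions R Q"
    and "is_subring_of R R'" and "is_subring_of R' Q"
    and "module_structure_extends R R' M"
  shows "trace_ideal R M \<subseteq> conductor R Q R'"
proof -
  interpret M: module R M by fact
  have "cring Q" and "is_subring_of R Q"
    using assms(2) by (auto simp: total_ring_of_fractions_def)
  interpret Q: cring Q by fact
  note RQ = is_subring_ofD[OF \<open>is_subring_of R Q\<close>]
    and R'Q = is_subring_ofD[OF assms(4)] and RR' = is_subring_ofD[OF assms(3)]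
  obtain sm where sm: "module R' (M\<lparr>smult := sm\<rparr>)"
    and ext: "\<And>r x. r \<in> carrier R \<Longrightarrow> x \<in> carrier M \<Longrightarrow> sm r x = r \<odot>\<^bsub>M\<^esub> x"
    using assms(5) by (auto simp: module_structure_extends_def)
  have gen: "f x \<in> conductor R Q R'"
    if f: "f \<in> carrier (dual_module R M)" and x: "x \<in> carrier M" for f x
  proof -
    have fx: "f x \<in> carrier R" by (rule dual_moduleD(1)[OF f x])
    have "f x \<otimes>\<^bsub>Q\<^esub> q \<in> carrier R" if q: "q \<in> carrier R'" for q
    proof -
      have qQ: "q \<in> carrier Q" using q R'Q(2) by blast
      obtain a s where a: "a \<in> carrier R" and s: "s \<in> regular_elements R"
        and qas: "q = a \<otimes>\<^bsub>Q\<^esub> inv\<^bsub>Q\<^esub> s"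
        using assms(2) qQ unfolding total_ring_of_fractions_def by blast
      have sR: "s \<in> carrier R" using s by (auto simp: regular_elements_def)
      have sU: "s \<in> Units Q" using s assms(2) by (auto simp: total_ring_of_fractions_def)
      have sQ: "s \<in> carrier Q" and aQ: "a \<in> carrier Q" and fxQ: "f x \<in> carrier Q"
        using sR a fx RQ(2) by auto
      \<comment> \<open>Clearing the denominator turns \<open>q\<close> into an element of
        \<open>R\<close>, over which \<open>f\<close> is linear.\<close>
      have sq: "s \<otimes>\<^bsub>Q\<^esub> q = a"
        using sQ aQ sU qas by (metis Q.Units_inv_closed Q.Units_r_inv Q.m_lcomm Q.r_one)
      have y: "sm q x \<in> carrier M"
        using module.smult_closed[OF sm q, of x] x by simp
      have fy: "f (sm q x) \<in> carrier R" by (rule dual_moduleD(1)[OF f y])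
      \<comment> \<open>Both \<open>s\<close> and \<open>a\<close> lie in \<open>R\<close>, where
        the two scalar multiplications agree; associativity over \<open>R'\<close> links them
        through \<open>q\<close>.\<close>
      have "s \<odot>\<^bsub>M\<^esub> sm q x = sm s (sm q x)" using ext sR y by simp
      also have "\<dots> = sm (s \<otimes>\<^bsub>R'\<^esub> q) x"
        using module.smult_assoc1[OF sm, of s q x] sR q x RR'(2) by auto
      also have "\<dots> = a \<odot>\<^bsub>M\<^esub> x" using sq R'Q(3) ext a x by simp
      finally have "f (s \<odot>\<^bsub>M\<^esub> sm q x) = f (a \<odot>\<^bsub>M\<^esub> x)" by simp
      then have "s \<otimes>\<^bsub>Q\<^esub> f (sm q x) = a \<otimes>\<^bsub>Q\<^esub> f x"
        using dual_moduleD(3)[OF f] sR y a x RQ(3) by simp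
      also have "\<dots> = s \<otimes>\<^bsub>Q\<^esub> (f x \<otimes>\<^bsub>Q\<^esub> q)"
        using sq sQ qQ fxQ by (metis Q.m_assoc Q.m_comm)
      \<comment> \<open>The unit \<open>s\<close> of \<open>Q\<close> is cancelled. The left side is
        a value of \<open>f\<close>, hence in \<open>R\<close>.\<close>
      finally have "f (sm q x) = f x \<otimes>\<^bsub>Q\<^esub> q"
        using sU fy fxQ qQ RQ(2) by (subst (asm) Q.Units_l_cancel) auto
      then show ?thesis using fy by simp
    qed
    then show ?thesis using fx RQ(2) by (auto simp: conductor_def)
  qed
  have "ideal (conductor R Q R') R"
    using conductor_ideal \<open>cring Q\<close> assms(4) \<open>is_subring_of R Q\<close> by blast
  then show ?thesis
    unfolding trace_ideal_def by (rule M.genideal_minimal) (use gen in blast)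
qed

section \<open>From the inclusion to a module structure over the extension\<close>

lemma extends_if_trace_subset_conductor:
  assumes "reflexive_module R M" and "cring Q"
    and "is_subring_of R Q" and "is_subring_of R R'" and "is_subring_of R' Q"
    and "trace_ideal R M \<subseteq> conductor R Q R'"
  shows "module_structure_extends R R' M"
proof -
  have mod: "module R M" using assms(1) by (simp add: reflexive_module_def)
  interpret M: module R M by fact
  interpret Q: cring Q by fact
  interpret R': cring R' using is_subring_of_cring assms(2,5) by blast
  note RQ = is_subring_ofD[OF assms(3)] and R'Q = is_subring_ofD[OF assms(5)]
  let ?D = "carrier (dual_module R M)"
  note D = dual_moduleD[of _ R M]
  have DQ: "f x \<in> carrier Q" if "f \<in> ?D" "x \<in> carrier M" for f x
    using D(1)[OF that] RQ(2) by blast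
  have R'Qc: "q \<in> carrier Q" if "q \<in> carrier R'" for q using that R'Q(2) by blast
  have R'Rc: "r \<in> carrier R'" if "r \<in> carrier R" for r
    using that is_subring_ofD(2)[OF assms(4)] by blast
  \<comment> \<open>Here the inclusion enters: it makes \<open>q\<close> times evaluation at
    \<open>x\<close> take values in \<open>R\<close> rather than only in \<open>Q\<close>.\<close>
  have tr: "q \<otimes>\<^bsub>Q\<^esub> f x \<in> carrier R"
    if q: "q \<in> carrier R'" and f: "f \<in> ?D" and x: "x \<in> carrier M" for q f x
  proof -
    have "{f x |f x. f \<in> ?D \<and> x \<in> carrier M} \<subseteq> carrier R" using D(1) by blast
    then have "f x \<in> trace_ideal R M"
      unfolding trace_ideal_def using M.genideal_self f x by blast
    then have "f x \<otimes>\<^bsub>Q\<^esub> q \<in> carrier R"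
      using assms(6) q by (auto simp: conductor_def)
    then show ?thesis using Q.m_comm[OF DQ[OF f x] R'Qc[OF q]] by simp
  qed
  have ex: "\<exists>y \<in> carrier M. \<forall>f \<in> ?D. f y = q \<otimes>\<^bsub>Q\<^esub> f x"
    if q: "q \<in> carrier R'" and x: "x \<in> carrier M" for q x
  proof -
    let ?\<phi> = "\<lambda>f \<in> ?D. q \<otimes>\<^bsub>Q\<^esub> f x"
    have "?\<phi> \<in> carrier (dual_module R (dual_module R M))"
      \<comment> \<open>The instance unfolds membership in the bidual only; membership in
        \<open>?D\<close> stays folded.\<close>
      unfolding dual_module_carrier_iff[of _ _ "dual_module R M"]
    proof (intro conjI ballI)
      show "?\<phi> \<in> ?D \<rightarrow>\<^sub>E carrier R" using tr[OF q _ x] by auto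
    next
      fix f g assume f: "f \<in> ?D" and g: "g \<in> ?D"
      show "?\<phi> (f \<oplus>\<^bsub>dual_module R M\<^esub> g) = ?\<phi> f \<oplus>\<^bsub>R\<^esub> ?\<phi> g"
        using f g x dual_module_add_closed[OF mod f g] RQ(4)
          Q.r_distr[OF DQ[OF f x] DQ[OF g x] R'Qc[OF q]] by simp
    next
      fix r f assume r: "r \<in> carrier R" and f: "f \<in> ?D"
      have "r \<in> carrier Q" using r RQ(2) by blast
      then show "?\<phi> (r \<odot>\<^bsub>dual_module R M\<^esub> f) = r \<otimes>\<^bsub>R\<^esub> ?\<phi> f"
        using f x dual_module_smult_closed[OF mod r f] RQ(3)
          Q.m_lcomm[OF R'Qc[OF q] _ DQ[OF f x]] by simp
    qed
    then obtain y where "y \<in> carrier M" "\<And>f. f \<in> ?D \<Longrightarrow> f y = ?\<phi> f"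
      using reflexive_module_evaluation[OF assms(1)] by blast
    then show ?thesis by auto
  qed
  \<comment> \<open>The choice is unique for \<open>q\<close> in \<open>R'\<close> and
    \<open>x\<close> in \<open>M\<close>, since forms separate points. Elsewhere \<open>sm\<close>
    is unspecified, and the module axioms range over the carriers only.\<close>
  define sm where "sm q x = (SOME y. y \<in> carrier M \<and> (\<forall>f \<in> ?D. f y = q \<otimes>\<^bsub>Q\<^esub> f x))" for q x
  have sm: "sm q x \<in> carrier M \<and> (\<forall>f \<in> ?D. f (sm q x) = q \<otimes>\<^bsub>Q\<^esub> f x)"
    if "q \<in> carrier R'" "x \<in> carrier M" for q x
    unfolding sm_def by (rule someI_ex) (use ex[OF that] in blast)
  then have smc: "sm q x \<in> carrier M" and smf: "f \<in> ?D \<Longrightarrow> f (sm q x) = q \<otimes>\<^bsub>Q\<^esub> f x"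
    if "q \<in> carrier R'" "x \<in> carrier M" for q x f
    using that by auto
  note sep = reflexive_module_separates[OF assms(1)]
  \<comment> \<open>The additive group is that of \<open>M\<close>. Each axiom on scalars is an
    equation in \<open>M\<close>; applying an arbitrary form turns it into the corresponding law of
    \<open>Q\<close>.\<close>
  have "module R' (M\<lparr>smult := sm\<rparr>)"
  proof (rule moduleI)
    show "cring R'" by (rule R'.is_cring)
    show "abelian_group (M\<lparr>smult := sm\<rparr>)"
      by (rule abelian_groupI)
        (auto simp: M.M.add.m_ac M.M.l_neg intro: M.M.add.l_inv_ex)
  next
    fix q x assume "q \<in> carrier R'" "x \<in> carrier (M\<lparr>smult := sm\<rparr>)"
    then show "q \<odot>\<^bsub>M\<lparr>smult := sm\<rparr>\<^esub> x \<in> carrier (M\<lparr>smult := sm\<rparr>)" using smc by simp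
  next
    fix p q x assume *: "p \<in> carrier R'" "q \<in> carrier R'" "x \<in> carrier (M\<lparr>smult := sm\<rparr>)"
    have "sm (p \<oplus>\<^bsub>R'\<^esub> q) x = sm p x \<oplus>\<^bsub>M\<^esub> sm q x"
      \<comment> \<open>The sum is first kept in \<open>R'\<close>, whose closure under addition
        lets \<open>smf\<close> apply to it; then everything is read in \<open>Q\<close>, where
        distributivity gives the claim.\<close>
      by (rule sep) (use * in \<open>auto simp: smc smf D(2) R'Q(4)[symmetric] RQ(4),
        simp add: R'Q(4) Q.l_distr R'Qc DQ\<close>)
    then show "(p \<oplus>\<^bsub>R'\<^esub> q) \<odot>\<^bsub>M\<lparr>smult := sm\<rparr>\<^esub> x =
        p \<odot>\<^bsub>M\<lparr>smult := sm\<rparr>\<^esub> x \<oplus>\<^bsub>M\<lparr>smult := sm\<rparr>\<^esub> q \<odot>\<^bsub>M\<lparr>smult := sm\<rparr>\<^esub> x" by simp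
  next
    fix q x y assume *: "q \<in> carrier R'" "x \<in> carrier (M\<lparr>smult := sm\<rparr>)"
      "y \<in> carrier (M\<lparr>smult := sm\<rparr>)"
    have "sm q (x \<oplus>\<^bsub>M\<^esub> y) = sm q x \<oplus>\<^bsub>M\<^esub> sm q y"
      by (rule sep) (use * in \<open>auto simp: smc smf D(2) RQ(4) Q.r_distr R'Qc DQ\<close>)
    then show "q \<odot>\<^bsub>M\<lparr>smult := sm\<rparr>\<^esub> (x \<oplus>\<^bsub>M\<lparr>smult := sm\<rparr>\<^esub> y) =
        q \<odot>\<^bsub>M\<lparr>smult := sm\<rparr>\<^esub> x \<oplus>\<^bsub>M\<lparr>smult := sm\<rparr>\<^esub> q \<odot>\<^bsub>M\<lparr>smult := sm\<rparr>\<^esub> y" by simp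
  next
    fix p q x assume *: "p \<in> carrier R'" "q \<in> carrier R'" "x \<in> carrier (M\<lparr>smult := sm\<rparr>)"
    have "sm (p \<otimes>\<^bsub>R'\<^esub> q) x = sm p (sm q x)"
      by (rule sep) (use * in \<open>auto simp: smc smf, simp add: R'Q(3) Q.m_assoc R'Qc DQ\<close>)
    then show "(p \<otimes>\<^bsub>R'\<^esub> q) \<odot>\<^bsub>M\<lparr>smult := sm\<rparr>\<^esub> x =
        p \<odot>\<^bsub>M\<lparr>smult := sm\<rparr>\<^esub> (q \<odot>\<^bsub>M\<lparr>smult := sm\<rparr>\<^esub> x)" by simp
  next
    fix x assume *: "x \<in> carrier (M\<lparr>smult := sm\<rparr>)"
    have "sm \<one>\<^bsub>R'\<^esub> x = x"
      by (rule sep) (use * in \<open>auto simp: smc smf, simp add: R'Q(5) DQ\<close>)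
    then show "\<one>\<^bsub>R'\<^esub> \<odot>\<^bsub>M\<lparr>smult := sm\<rparr>\<^esub> x = x" by simp
  qed
  \<comment> \<open>For \<open>r\<close> in \<open>R\<close>, linearity of a form \<open>f\<close>
    gives both sides the value r f x.\<close>
  moreover have "sm r x = r \<odot>\<^bsub>M\<^esub> x" if "r \<in> carrier R" "x \<in> carrier M" for r x
    by (rule sep) (use that R'Rc in \<open>auto simp: smc smf D(3) RQ(3)\<close>)
  ultimately show ?thesis
    unfolding module_structure_extends_def by blast
qed

theorem theorem3p5:
  fixes R Q R' :: "'a ring" and M :: "('a, 'c) module"
  assumes "local_cring R" and "noetherian_ring R" and "reduced_ring R"
    and "fin_gen_module R M" and "reflexive_module R M"
    and "finite_birational_extension R Q R'"
  shows "trace_ideal R M \<subseteq> conductor R Q R' \<longleftrightarrow> module_structure_extends R R' M"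
proof -
  have "module R M" using assms(5) by (simp add: reflexive_module_def)
  moreover have Q: "total_ring_of_fractions R Q" "is_subring_of R R'" "is_subring_of R' Q"
    using assms(6) by (auto simp: finite_birational_extension_def)
  moreover from Q have "cring Q" "is_subring_of R Q"
    by (auto simp: total_ring_of_fractions_def)
  ultimately show ?thesis
    using trace_subset_conductor_if_extends extends_if_trace_subset_conductor assms(5) by blast
qed

end
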